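(* $$\int_{0}^{1}\frac{\ln t}{1-t}\,dt=2\int_{0}^{1}\frac{\ln t}{1+t}\,dt.$$
   Context: Both integrals are convergent improper (equivalently Lebesgue) integrals over $(0,1)$; $\ln$ is the natural logarithm. *)

theory Defs
  imports "HOL-Analysis.Analysis"
begin

end

theory Submission
  imports Defs
begin

text \<open>
  Write \<open>A\<close> for the integral of \<open>ln t / (1 - t)\<close> and \<open>B\<close> for that of \<open>ln t / (1 + t)\<close>.  Subtracting
  the integrands gives \<open>A - B = \<integral> 2 t ln t / (1 - t\<^sup>2)\<close>.  Since \<open>ln (t\<^sup>2) = 2 ln t\<close>, the pullback of
  \<open>ln u / (1 - u)\<close> along \<open>u = t\<^sup>2\<close> is exactly twice this integrand, so \<open>A = 2 (A - B)\<close> and hence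
  \<open>A = 2 B\<close>; neither value has to be computed.

  The same substitution settles integrability.  The pullback is bounded on \<open>(0,1)\<close>
  (\<open>square_pullback_bound\<close>), and because \<open>ln u / (1 - u)\<close> has constant sign, integrability
  transfers from the pullback to the function itself (\<open>square_substitution\<close>).
  It passes to \<open>ln t / (1 + t)\<close> by comparison.
\<close>

text \<open>
  The factor \<open>2 t\<close> removes the singularity at \<open>0\<close> and \<open>1 - t\<^sup>2\<close> is compensated by the zero of the
  logarithm at \<open>1\<close>: both effects are contained in \<open>- ln t \<le> 1 / t - 1\<close>.
\<close>
lemma square_pullback_bound:
  fixes t :: real
  assumes "0 < t" "t < 1"
  shows "\<bar>- ln (t\<^sup>2) / (1 - t\<^sup>2) * (2 * t)\<bar> \<le> 4"
proof -
  have "- ln t \<le> 1 / t - 1"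
    using ln_le_minus_one[of "1 / t"] assms by (simp add: ln_div)
  then have log: "- ln t * t \<le> 1 - t"
    using assms by (simp add: field_simps)
  have pos: "0 < 1 - t\<^sup>2"
    using assms by (simp add: power_less_one_iff)
  have neg: "ln t < 0"
    using assms by simp
  have "1 - t \<le> 1 - t\<^sup>2"
    using assms by (simp add: power2_eq_square)
  with log have "- ln t * t \<le> 1 - t\<^sup>2"
    by linarith
  then have "4 * (- ln t * t) / (1 - t\<^sup>2) \<le> 4"
    unfolding pos_divide_le_eq[OF pos] by (rule mult_left_mono) simp
  moreover have "- ln (t\<^sup>2) / (1 - t\<^sup>2) * (2 * t) = 4 * (- ln t * t) / (1 - t\<^sup>2)"
    using assms by (simp add: ln_realpow)
  moreover have "0 \<le> 4 * (- ln t * t) / (1 - t\<^sup>2)"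
    using pos neg assms by (intro divide_nonneg_pos mult_nonneg_nonneg) auto
  ultimately show ?thesis
    by (simp only: abs_of_nonneg)
qed

lemma square_pullback_integrable:
  "set_integrable lborel {0<..<1::real} (\<lambda>t. - ln (t\<^sup>2) / (1 - t\<^sup>2) * (2 * t))"
proof (rule set_integrable_bound)
  show "set_integrable lborel {0<..<1::real} (\<lambda>t. 4::real)"
    unfolding set_integrable_def by (intro integrable_scaleR_left) simp
  show "set_borel_measurable lborel {0<..<1::real} (\<lambda>t. - ln (t\<^sup>2) / (1 - t\<^sup>2) * (2 * t))"
    unfolding set_borel_measurable_def by measurable
  show "AE t in lborel. t \<in> {0<..<1::real} \<longrightarrow>
      norm (- ln (t\<^sup>2) / (1 - t\<^sup>2) * (2 * t)) \<le> norm (4::real)"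
    using square_pullback_bound by (intro AE_I2) (auto simp del: ln_realpow)
qed

text \<open>
  The minus sign makes the integrand nonnegative, so that by monotone convergence integrability is
  a conclusion of the change of variables \<open>u = t\<^sup>2\<close>, following from that of the pullback.
\<close>
lemma square_substitution:
  shows "set_integrable lborel {0<..<1::real} (\<lambda>u. - ln u / (1 - u))"
    and "(LBINT u:{0<..<1::real}. - ln u / (1 - u)) =
         (LBINT t:{0<..<1::real}. - ln (t\<^sup>2) / (1 - t\<^sup>2) * (2 * t))"
proof -
  have unit: "einterval 0 1 = {0<..<1::real}"
    by (auto simp: einterval_def)
  let ?f = "\<lambda>u::real. - ln u / (1 - u)"
  let ?g = "\<lambda>t::real. t\<^sup>2" and ?g' = "\<lambda>t::real. 2 * t"
  have sq: "0 < t\<^sup>2 \<and> t\<^sup>2 < 1" if "0 < ereal t" "ereal t < 1" for t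
    using that by (simp add: power_less_one_iff)
  have lims: "((ereal \<circ> ?g \<circ> real_of_ereal) \<longlongrightarrow> 0) (at_right 0)"
    "((ereal \<circ> ?g \<circ> real_of_ereal) \<longlongrightarrow> 1) (at_left 1)"
    unfolding zero_ereal_def one_ereal_def ereal_tendsto_simps
    by (auto intro!: tendsto_eq_intros)
  have deriv: "DERIV ?g t :> ?g' t" if "0 < ereal t" "ereal t < 1" for t
    by (auto intro!: derivative_eq_intros)
  have cont: "isCont ?f (?g t)" if "0 < ereal t" "ereal t < 1" for t
    using sq[OF that] by (intro continuous_intros) auto
  have nonneg: "0 \<le> ?f (?g t)" if "0 < ereal t" "ereal t < 1" for t
    using sq[OF that] by (intro divide_nonneg_pos) (auto simp del: ln_realpow)
  have pullback: "set_integrable lborel (einterval 0 1) (\<lambda>t. ?f (?g t) * ?g' t)"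
    using square_pullback_integrable by (simp only: unit)
  have cont': "isCont ?g' t" if "0 < ereal t" "ereal t < 1" for t
    by (intro continuous_intros)
  have nonneg': "0 \<le> ?g' t" if "0 \<le> ereal t" "ereal t \<le> 1" for t
    using that by simp
  have "(0::ereal) < 1"
    by simp
  note subst = interval_integral_substitution_nonneg[where f = ?f and g = ?g and g' = ?g',
      OF this deriv cont cont' nonneg nonneg' lims pullback]
  show "set_integrable lborel {0<..<1::real} ?f"
    using subst(1) by (simp only: unit)
  show "(LBINT u:{0<..<1::real}. ?f u) = (LBINT t:{0<..<1::real}. ?f (?g t) * ?g' t)"
    using subst(2) by (simp add: interval_lebesgue_integral_le_eq unit)
qed

theorem mainTheorem2:
  shows "set_integrable lborel {0<..<1} (\<lambda>t::real. ln t / (1 - t))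
       \<and> set_integrable lborel {0<..<1} (\<lambda>t::real. ln t / (1 + t))
       \<and> (LBINT t:{0<..<1::real}. ln t / (1 - t)) = 2 * (LBINT t:{0<..<1::real}. ln t / (1 + t))"
proof -
  let ?a = "\<lambda>t::real. ln t / (1 - t)" and ?b = "\<lambda>t::real. ln t / (1 + t)"
  let ?A = "LBINT t:{0<..<1}. ?a t" and ?B = "LBINT t:{0<..<1}. ?b t"
  have a: "set_integrable lborel {0<..<1} ?a"
    using set_integrable_mult_right[of "-1", OF square_substitution(1)] by simp
  have b: "set_integrable lborel {0<..<1} ?b"
  proof (rule set_integrable_bound[OF a])
    show "set_borel_measurable lborel {0<..<1} ?b"
      unfolding set_borel_measurable_def by measurable
    show "AE t in lborel. t \<in> {0<..<1} \<longrightarrow> norm (?b t) \<le> norm (?a t)"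
      proof (intro AE_I2 impI)
      fix t :: real
      assume "t \<in> {0<..<1}"
      then have "\<bar>ln t\<bar> / \<bar>1 + t\<bar> \<le> \<bar>ln t\<bar> / \<bar>1 - t\<bar>"
        by (intro divide_left_mono) auto
      then show "norm (?b t) \<le> norm (?a t)"
        by (simp only: real_norm_def abs_divide)
    qed
  qed
  have pullback: "- ln (t\<^sup>2) / (1 - t\<^sup>2) * (2 * t) = - 2 * (?a t - ?b t)"
    if "t \<in> {0<..<1}" for t :: real
  proof -
    have "1 - t\<^sup>2 = (1 - t) * (1 + t)"
      by (simp add: power2_eq_square algebra_simps)
    moreover have "1 - t \<noteq> 0" "1 + t \<noteq> 0"
      using that by auto
    ultimately show ?thesis
      using that by (simp add: ln_realpow divide_simps) (simp add: algebra_simps)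
  qed
  have "- ?A = (LBINT t:{0<..<1}. - ?a t)"
    using a by (simp add: set_integral_uminus)
  also have "\<dots> = (LBINT t:{0<..<1::real}. - ln (t\<^sup>2) / (1 - t\<^sup>2) * (2 * t))"
    using square_substitution(2) by simp
  also have "\<dots> = (LBINT t:{0<..<1}. - 2 * (?a t - ?b t))"
    using pullback by (intro set_lebesgue_integral_cong) auto
  also have "\<dots> = - 2 * (?A - ?B)"
    using a b by (simp only: set_integral_mult_right set_integral_diff(2))
  finally have "?A = 2 * ?B"
    by simp
  with a b show ?thesis
    by blast
qed

end
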